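(* Let $(\Omega',\mathfrak F',(\mathfrak F'_t)_{0\le t\le T},\mathbb P')$ and $(\Omega'',\mathfrak F'',(\mathfrak F''_t)_{0\le t\le T},\mathbb P'')$ be complete filtered probability spaces, with (completed) product $(\Omega,\mathfrak F,(\mathfrak F_t)_t,\mathbb P)$ as in the context. Let $\alpha\in(1/3,1/2)$, let $\mathscr C_T$ be a Polish space of $\alpha$-Hölder rough paths on $[0,T]$ over $\mathbb R^{d_Y}$ with Borel $\sigma$-field $\mathfrak C_T$, and let $X=\{X^{\mathbf Y}:\mathbf Y\in\mathscr C_T\}$ be a rough Itô process on $\Omega'$, $$X^{\mathbf Y}_t(\omega')=X^{\mathbf Y}_0(\omega')+\int_0^t A_s(\omega',\mathbf Y)\,ds+\int_0^t\Sigma_s(\omega',\mathbf Y)\,dB_s(\omega')+\int_0^t(F_s,F'_s)(\omega',\mathbf Y)\,d\mathbf Y_s,\qquad 0\le t\le T,$$ with $B$ an $(\mathfrak F'_t)$-Brownian motion and coefficient fields satisfying, on $\Omega'$, Assumption 1 and Assumption 2 (either (A2.opt) or (A2.prog)) of the context; $X$ denotes its $\mathfrak C_T$-optional (resp. $\mathfrak C_T$-progressive) version. Let $\mathbf W:(\Omega'',\mathfrak F''_T,\mathbb P'')\to(\mathscr C_T,\mathfrak C_T)$ be measurable and adapted, in the sense that $\mathbf W_t$ is $\mathfrak F''_t$-measurable for every $t$. Then: (i) The randomised rough Itô process $$\bar X_t(\omega):=X_t^{\mathbf W(\omega'')}(\omega')=X^{\mathbf Y}_t(\omega')\big|_{\mathbf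 Y=\mathbf W(\omega'')},\qquad \omega=(\omega',\omega''),$$ defines a $(\mathfrak F'_t\vee\mathfrak F''_T:0\le t\le T)$-adapted process. (ii) For any $0\le t\le T$, $$\operatorname{Law}(\bar X_t\,|\,\mathfrak F''_T)(\omega)=\operatorname{Law}(X^{\mathbf Y}_t)\big|_{\mathbf Y=\mathbf W(\omega)},$$ where $\omega\mapsto\operatorname{Law}(X^{\mathbf Y}_t)|_{\mathbf Y=\mathbf W(\omega)}$ is a regular conditional distribution of $\bar X_t$ given $\mathfrak F''_T$. (iii) If $\alpha p>1$, where $p$ is the integrability exponent in Assumption 1, then the process $\bar X$ admits a continuous modification.
   Context: All processes are finite-dimensional: $X\in\mathbb R^{d_X}$, $B\in\mathbb R^{d_B}$, $Y\in\mathbb R^{d_Y}$, with $A,\Sigma,F,F'$ of matching dimensions ($F_t\in L(\mathbb R^{d_Y};\mathbb R^{d_X})$, $F'_t\in L(\mathbb R^{d_Y}\otimes\mathbb R^{d_Y};\mathbb R^{d_X})$, and $F'_s(\delta Y)_{s,t}$ denotes the element $z\mapsto F'_s((\delta Y)_{s,t}\otimes z)$ of $L(\mathbb R^{d_Y};\mathbb R^{d_X})$). Product space. $\Omega=\Omega'\times\Omega''$, $\omega=(\omega',\omega'')$, $\mathbb P=\mathbb P'\otimes\mathbb P''$ (completed), $\mathfrak F_t=(\mathfrak F'_t\otimes\mathfrak F''_t)\vee\mathfrak N$ with $\mathfrak N$ the $\mathbb P$-negligible sets. Objects and $\sigma$-fields on $\Omega'$ and $\Omega''$ are lifted to $\Omega$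 in the natural way: $X^{\mathbf Y}(\omega)=X^{\mathbf Y}(\omega')$, $\mathbf W(\omega)=\mathbf W(\omega'')$, $A'\in\mathfrak F'_t$ is identified with $A'\times\Omega''$, and $A''\in\mathfrak F''_t$ with $\Omega'\times A''$. A filtration is complete if its time-$0$ $\sigma$-field contains all negligible sets. Rough paths. For a path $Y$ write $(\delta Y)_{s,t}=Y_t-Y_s$. An $\alpha$-Hölder rough path on $[0,T]$ is a pair $\mathbf Y=(Y,\mathbb Y)$ with $|\delta Y|_\alpha=\sup_{s<t}|(\delta Y)_{s,t}|/|t-s|^\alpha<\infty$, $|\mathbb Y|_{2\alpha}=\sup_{s<t}|\mathbb Y_{s,t}|/|t-s|^{2\alpha}<\infty$ and Chen's relation $\mathbb Y_{s,t}=\mathbb Y_{s,u}+\mathbb Y_{u,t}+(\delta Y)_{s,u}\otimes(\delta Y)_{u,t}$. The space of these is $\mathscr C^\alpha_T$, with metric $\rho_\alpha(\mathbf Y,\bar{\mathbf Y})=|\delta Y-\delta\bar Y|_\alpha+|\mathbb Y-\bar{\mathbb Y}|_{2\alpha}$ (paths with the same increments being identified). A Polish space of $\alpha$-Hölder rough paths is a Polish metric space $(\mathscr C_T,\rho)$ of rough paths with continuous embedding $(\mathscr C_T,\rho)\hookrightarrow(\mathscr C^\alpha_T,\rho_\alpha)$. For a rough path $\mathbf Y$, $\mathbf Y_t$ denotes its value at time $t$, i.e. $((\delta Y)_{0,t},\mathbb Y_{0,t})$. Measurability. $\mathfrak O_T$ is the optional $\sigma$-field on $[0,T]\times\Omega'$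 (the smallest making all adapted càdlàg processes measurable), $\Pi_T$ the progressive $\sigma$-field (the smallest making all progressively measurable processes measurable). A map of $(\mathbf Y,t,\omega')$ is $\mathfrak C_T$-optional (resp. $\mathfrak C_T$-progressive) if it is $(\mathfrak C_T\otimes\mathfrak O_T)$-measurable (resp. $(\mathfrak C_T\otimes\Pi_T)$-measurable). A version of $X$ is a map $\tilde X$ of $(t,\omega',\mathbf Y)$ such that for each $\mathbf Y$ the processes $\tilde X^{\mathbf Y}$ and $X^{\mathbf Y}$ are indistinguishable. Under Assumptions 1 and 2 a $\mathfrak C_T$-optional (under (A2.opt)), resp. $\mathfrak C_T$-progressive (under (A2.prog)), version of $X$ exists. Write $\Theta_t^{\mathbf Y}(\omega')=\Theta_t(\omega';\mathbf Y)=\Theta_t(\omega',\mathbf Y)$ for any coefficient field $\Theta\in\{A,\Sigma,F,F'\}$, likewise $X_0^{\mathbf Y}(\omega')=X_0(\omega';\mathbf Y)$. Below, on $\Omega'$, $\mathbb E_s=\mathbb E'[\,\cdot\,|\mathfrak F'_s]$ and $\|\cdot\|_p$ is the $L^p(\mathbb P')$-norm. Fix an integrability exponent $p\in[2,\infty)$. Assumption 1. For each $\mathbf Y\in\mathscr C_T$: (a) each coefficient field $(t,\omega')\mapsto\Theta^{\mathbf Y}_t(\omega')$ is progressively measurable; (b) for a.e. $\omega'$, $A^{\mathbf Y}\in L^1([0,T])$ and $(\Sigma\Sigma^T)^{\mathbf Y}\in L^1([0,T])$; (c) with $R^F_{s,t}:=F_t(\omega';\mathbf Y)-F_s(\omega';\mathbf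 Y)-F'_s(\omega';\mathbf Y)(Y_t-Y_s)$, $$\|F\|_{\alpha;p}+\|F'\|_{\alpha;p}+\|\mathbb E_\bullet R^F\|_{2\alpha;p}<\infty,$$ where $\|G\|_{\alpha;p}=\sup_t\|G_t\|_p+\sup_{s<t}\frac{\|G_t-G_s\|_p}{|t-s|^\alpha}$ and $\|\mathbb E_\bullet R\|_{2\alpha;p}=\sup_{s<t}\frac{\|\mathbb E_sR_{s,t}\|_p}{|t-s|^{2\alpha}}$. Assumption 2, in the form (A2.opt) (resp. (A2.prog)). Each $\Theta\in\{A,\Sigma,F,F'\}$ is $\mathfrak C_T$-optional (resp. $\mathfrak C_T$-progressive) as a map $(\mathbf Y;(t,\omega'))\mapsto\Theta_t(\omega';\mathbf Y)$, and $(\mathbf Y;\omega')\mapsto X_0(\omega';\mathbf Y)$ is $(\mathfrak C_T\otimes\mathfrak F'_0)$-measurable. Rough stochastic integral. Under Assumption 1, $\int_0^t(F_s,F'_s)(\omega',\mathbf Y)\,d\mathbf Y_s$ denotes the limit in $L^p(\mathbb P')$, as the mesh of the partition $\pi$ of $[0,t]$ tends to $0$, of $\sum_{[u,v]\in\pi}\big(F_u(\delta Y)_{u,v}+F'_u\mathbb Y_{u,v}\big)$, taken as a continuous adapted process in $t$; the other two integrals are Lebesgue and Itô integrals. A rough Itô process is the family of continuous adapted processes $X^{\mathbf Y}$, $\mathbf Y\in\mathscr C_T$, satisfying the displayed identity of the claim almost surely for each $\mathbf Y$. *)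

theory Defs
  imports "HOL-Probability.Probability"
begin

section \<open>Filtered probability spaces and processes on \<open>[0,T]\<close>\<close>

text \<open>
  A stochastic process is a function of time and \<open>\<omega>\<close>, a filtration is a family of
  \<open>\<sigma>\<close>-fields, represented as measure spaces of which only the measurable sets matter.
  Both are only looked at on \<open>[0,T]\<close>.
\<close>

definition complete_filtered_prob_space ::
  "real \<Rightarrow> 'a measure \<Rightarrow> (real \<Rightarrow> 'a measure) \<Rightarrow> bool" where
  "complete_filtered_prob_space T M \<FF> \<longleftrightarrow>
     prob_space M \<and> complete_measure M \<and>
     (\<forall>t\<in>{0..T}. subalgebra M (\<FF> t)) \<and>
     (\<forall>s t. 0 \<le> s \<and> s \<le> t \<and> t \<le> T \<longrightarrow> sets (\<FF> s) \<subseteq> sets (\<FF> t)) \<and>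
     null_sets M \<subseteq> sets (\<FF> 0)"

definition adapted :: "real \<Rightarrow> (real \<Rightarrow> 'a measure) \<Rightarrow> (real \<Rightarrow> 'a \<Rightarrow> 'e::topological_space) \<Rightarrow> bool" where
  "adapted T \<FF> Z \<longleftrightarrow> (\<forall>t\<in>{0..T}. Z t \<in> borel_measurable (\<FF> t))"

definition cadlag_on :: "real \<Rightarrow> (real \<Rightarrow> 'e::topological_space) \<Rightarrow> bool" where
  "cadlag_on T z \<longleftrightarrow>
     (\<forall>t. 0 \<le> t \<and> t < T \<longrightarrow> (z \<longlongrightarrow> z t) (at_right t)) \<and>
     (\<forall>t. 0 < t \<and> t \<le> T \<longrightarrow> (\<exists>l. (z \<longlongrightarrow> l) (at_left t)))"

definition continuous_adapted ::
  "real \<Rightarrow> 'a measure \<Rightarrow> (real \<Rightarrow> 'a measure) \<Rightarrow> (real \<Rightarrow> 'a \<Rightarrow> 'e::topological_space) \<Rightarrow> bool" where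
  "continuous_adapted T M \<FF> Z \<longleftrightarrow>
     adapted T \<FF> Z \<and> (\<forall>\<omega>\<in>space M. continuous_on {0..T} (\<lambda>t. Z t \<omega>))"

definition progressively_measurable ::
  "real \<Rightarrow> (real \<Rightarrow> 'a measure) \<Rightarrow> (real \<Rightarrow> 'a \<Rightarrow> 'e::topological_space) \<Rightarrow> bool" where
  "progressively_measurable T \<FF> Z \<longleftrightarrow>
     (\<forall>t\<in>{0..T}. (\<lambda>(s, \<omega>). Z s \<omega>) \<in> borel_measurable (restrict_space borel {0..t} \<Otimes>\<^sub>M \<FF> t))"

text \<open>
  Real-valued generators suffice: a process with values in a Euclidean space is
  cadlag and adapted (or progressively measurable) iff all its coordinates are.
\<close>

definition optional_sigma :: "real \<Rightarrow> 'a measure \<Rightarrow> (real \<Rightarrow> 'a measure) \<Rightarrow> (real \<times> 'a) measure" where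
  "optional_sigma T M \<FF> = sigma ({0..T} \<times> space M)
     {{(t, \<omega>) \<in> {0..T} \<times> space M. Z t \<omega> \<in> D} | (Z :: real \<Rightarrow> 'a \<Rightarrow> real) D.
        adapted T \<FF> Z \<and> (\<forall>\<omega>\<in>space M. cadlag_on T (\<lambda>t. Z t \<omega>)) \<and> D \<in> sets borel}"

definition progressive_sigma :: "real \<Rightarrow> 'a measure \<Rightarrow> (real \<Rightarrow> 'a measure) \<Rightarrow> (real \<times> 'a) measure" where
  "progressive_sigma T M \<FF> = sigma ({0..T} \<times> space M)
     {{(t, \<omega>) \<in> {0..T} \<times> space M. Z t \<omega> \<in> D} | (Z :: real \<Rightarrow> 'a \<Rightarrow> real) D.
        progressively_measurable T \<FF> Z \<and> D \<in> sets borel}"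

definition indistinguishable ::
  "real \<Rightarrow> 'a measure \<Rightarrow> (real \<Rightarrow> 'a \<Rightarrow> 'e) \<Rightarrow> (real \<Rightarrow> 'a \<Rightarrow> 'e) \<Rightarrow> bool" where
  "indistinguishable T M Z Z' \<longleftrightarrow> (AE \<omega> in M. \<forall>t\<in>{0..T}. Z t \<omega> = Z' t \<omega>)"

definition continuous_modification ::
  "real \<Rightarrow> 'a measure \<Rightarrow> (real \<Rightarrow> 'a \<Rightarrow> 'e::topological_space) \<Rightarrow> (real \<Rightarrow> 'a \<Rightarrow> 'e) \<Rightarrow> bool" where
  "continuous_modification T M Z Z' \<longleftrightarrow>
     (\<forall>t\<in>{0..T}. Z' t \<in> borel_measurable M) \<and>
     (\<forall>\<omega>\<in>space M. continuous_on {0..T} (\<lambda>t. Z' t \<omega>)) \<and>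
     (\<forall>t\<in>{0..T}. AE \<omega> in M. Z' t \<omega> = Z t \<omega>)"

definition join_sigma :: "'a measure \<Rightarrow> 'a measure \<Rightarrow> 'a measure" where
  "join_sigma M N = sigma (space M) (sets M \<union> sets N)"

definition regular_conditional_distribution ::
  "'a measure \<Rightarrow> 'a measure \<Rightarrow> ('a \<Rightarrow> 'e::topological_space) \<Rightarrow> ('a \<Rightarrow> 'e measure) \<Rightarrow> bool" where
  "regular_conditional_distribution M G Z \<kappa> \<longleftrightarrow>
     subalgebra M G \<and> Z \<in> borel_measurable M \<and>
     \<kappa> \<in> G \<rightarrow>\<^sub>M prob_algebra borel \<and>
     (\<forall>D\<in>sets borel. AE \<omega> in M.
        real_cond_exp M G (\<lambda>\<omega>. indicator D (Z \<omega>)) \<omega> = measure (\<kappa> \<omega>) D)"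

definition vec_cond_exp ::
  "'a measure \<Rightarrow> 'a measure \<Rightarrow> ('a \<Rightarrow> 'e::euclidean_space) \<Rightarrow> 'a \<Rightarrow> 'e" where
  "vec_cond_exp M G Z \<omega> = (\<Sum>b\<in>Basis. real_cond_exp M G (\<lambda>\<omega>. Z \<omega> \<bullet> b) \<omega> *\<^sub>R b)"

definition Lp_norm :: "'a measure \<Rightarrow> real \<Rightarrow> ('a \<Rightarrow> 'e::real_normed_vector) \<Rightarrow> ennreal" where
  "Lp_norm M p Z =
     (if integrable M (\<lambda>\<omega>. norm (Z \<omega>) powr p)
      then ennreal ((\<integral>\<omega>. norm (Z \<omega>) powr p \<partial>M) powr (1 / p)) else \<infinity>)"


section \<open>Rough paths\<close>

text \<open>
  \<open>\<real>\<^sup>d \<otimes> \<real>\<^sup>d\<close> is the space of \<open>d \<times> d\<close> arrays.  The space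
  \<open>L(\<real>\<^sup>d;\<real>\<^sup>n)\<close> consists of matrices and
  \<open>L(\<real>\<^sup>d \<otimes> \<real>\<^sup>d;\<real>\<^sup>n)\<close> of arrays \<open>G $ i $ j $ k\<close>, acting by
  contraction over \<open>j\<close> and \<open>k\<close>.
\<close>

type_synonym 'd tensor2 = "real ^ 'd ^ 'd"
type_synonym 'd rpath = "(real \<Rightarrow> real ^ 'd) \<times> (real \<Rightarrow> real \<Rightarrow> real ^ 'd ^ 'd)"

definition tensor :: "real ^ 'd \<Rightarrow> real ^ 'd \<Rightarrow> 'd tensor2" where
  "tensor x y = (\<chi> i j. x $ i * y $ j)"

definition tensor_apply :: "real ^ 'd ^ 'd ^ 'n \<Rightarrow> 'd tensor2 \<Rightarrow> real ^ 'n" where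
  "tensor_apply G Q = (\<chi> i. \<Sum>j\<in>UNIV. \<Sum>k\<in>UNIV. G $ i $ j $ k * Q $ j $ k)"

definition tensor_curry :: "real ^ 'd ^ 'd ^ 'n \<Rightarrow> real ^ 'd \<Rightarrow> real ^ 'd ^ 'n" where
  "tensor_curry G y = (\<chi> i k. \<Sum>j\<in>UNIV. G $ i $ j $ k * y $ j)"

lemma tensor_curry_apply: "tensor_curry G y *v z = tensor_apply G (tensor y z)"
proof -
  have "(\<Sum>k\<in>UNIV. (\<Sum>j\<in>UNIV. G $ i $ j $ k * y $ j) * z $ k) =
        (\<Sum>j\<in>UNIV. \<Sum>k\<in>UNIV. G $ i $ j $ k * (y $ j * z $ k))" for i
    by (subst sum.swap) (simp add: sum_distrib_right mult.assoc)
  then show ?thesis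
    by (simp add: tensor_curry_def tensor_apply_def tensor_def matrix_vector_mult_def)
qed

definition incr :: "(real \<Rightarrow> 'e::ab_group_add) \<Rightarrow> real \<Rightarrow> real \<Rightarrow> 'e" where
  "incr y s t = y t - y s"

definition hoelder_seminorm :: "real \<Rightarrow> real \<Rightarrow> (real \<Rightarrow> real \<Rightarrow> 'e::real_normed_vector) \<Rightarrow> ennreal" where
  "hoelder_seminorm T \<beta> G =
     (SUP (s, t) \<in> {(s, t). 0 \<le> s \<and> s < t \<and> t \<le> T}. ennreal (norm (G s t) / (t - s) powr \<beta>))"

text \<open>
  Paths with the same increments are identified, so an element of the space is represented
  by the path started at \<open>0\<close>; the first component vanishes outside \<open>[0,T]\<close> and the
  second one outside \<open>0 \<le> s \<le> t \<le> T\<close>, where they carry no information.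
\<close>

definition rough_paths :: "real \<Rightarrow> real \<Rightarrow> ('d::finite) rpath set" where
  "rough_paths T \<alpha> = {(Y, YY).
     Y 0 = 0 \<and> (\<forall>t. t \<notin> {0..T} \<longrightarrow> Y t = 0) \<and>
     (\<forall>s t. \<not> (0 \<le> s \<and> s \<le> t \<and> t \<le> T) \<longrightarrow> YY s t = 0) \<and>
     hoelder_seminorm T \<alpha> (incr Y) < \<infinity> \<and>
     hoelder_seminorm T (2 * \<alpha>) YY < \<infinity> \<and>
     (\<forall>s u t. 0 \<le> s \<and> s \<le> u \<and> u \<le> t \<and> t \<le> T \<longrightarrow>
        YY s t = YY s u + YY u t + tensor (incr Y s u) (incr Y u t))}"

definition rough_dist :: "real \<Rightarrow> real \<Rightarrow> ('d::finite) rpath \<Rightarrow> 'd rpath \<Rightarrow> real" where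
  "rough_dist T \<alpha> Y Z = enn2real (
     hoelder_seminorm T \<alpha> (\<lambda>s t. incr (fst Y) s t - incr (fst Z) s t) +
     hoelder_seminorm T (2 * \<alpha>) (\<lambda>s t. snd Y s t - snd Z s t))"

lemma hoelder_seminorm_le_iff:
  "hoelder_seminorm T \<beta> G \<le> c \<longleftrightarrow>
     (\<forall>s t. 0 \<le> s \<and> s < t \<and> t \<le> T \<longrightarrow> ennreal (norm (G s t) / (t - s) powr \<beta>) \<le> c)"
  unfolding hoelder_seminorm_def by (auto simp: SUP_le_iff)

lemma hoelder_seminorm_triangle:
  assumes "\<And>s t. norm (K s t) \<le> norm (G s t) + norm (H s t)"
  shows "hoelder_seminorm T \<beta> K \<le> hoelder_seminorm T \<beta> G + hoelder_seminorm T \<beta> H"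
  unfolding hoelder_seminorm_le_iff
proof (intro allI impI)
  fix s t :: real assume st: "0 \<le> s \<and> s < t \<and> t \<le> T"
  have "ennreal (norm (K s t) / (t - s) powr \<beta>) \<le>
        ennreal (norm (G s t) / (t - s) powr \<beta> + norm (H s t) / (t - s) powr \<beta>)"
    by (intro ennreal_leI) (metis add_divide_distrib divide_right_mono assms powr_ge_zero)
  also have "\<dots> = ennreal (norm (G s t) / (t - s) powr \<beta>) + ennreal (norm (H s t) / (t - s) powr \<beta>)"
    by (rule ennreal_plus) auto
  also have "\<dots> \<le> hoelder_seminorm T \<beta> G + hoelder_seminorm T \<beta> H"
    using st hoelder_seminorm_le_iff[of T \<beta> G] hoelder_seminorm_le_iff[of T \<beta> H]
    by (intro add_mono) blast+
  finally show "ennreal (norm (K s t) / (t - s) powr \<beta>) \<le>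
      hoelder_seminorm T \<beta> G + hoelder_seminorm T \<beta> H" .
qed

lemma hoelder_seminorm_eq_0_iff:
  "hoelder_seminorm T \<beta> G = 0 \<longleftrightarrow> (\<forall>s t. 0 \<le> s \<and> s < t \<and> t \<le> T \<longrightarrow> G s t = 0)"
proof -
  have "ennreal (norm (G s t) / (t - s) powr \<beta>) \<le> 0 \<longleftrightarrow> G s t = 0" if "s < t" for s t
    using that by (auto simp: ennreal_eq_0_iff divide_le_0_iff)
  then show ?thesis
    using hoelder_seminorm_le_iff[of T \<beta> G 0] by auto
qed

lemma rough_paths_diag: "Y \<in> rough_paths T \<alpha> \<Longrightarrow> snd Y s s = 0"
proof (cases "0 \<le> s \<and> s \<le> T")
  case True
  assume "Y \<in> rough_paths T \<alpha>"
  then have "\<forall>s u t. 0 \<le> s \<and> s \<le> u \<and> u \<le> t \<and> t \<le> T \<longrightarrow>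
      snd Y s t = snd Y s u + snd Y u t + tensor (incr (fst Y) s u) (incr (fst Y) u t)"
    by (simp add: rough_paths_def case_prod_beta)
  then have "snd Y s s = snd Y s s + snd Y s s + tensor (incr (fst Y) s s) (incr (fst Y) s s)"
    using True by (metis order_refl)
  moreover have "tensor (incr (fst Y) s s) (incr (fst Y) s s) = 0"
    by (simp add: incr_def tensor_def vec_eq_iff)
  ultimately show ?thesis by simp
qed (auto simp: rough_paths_def case_prod_beta)

lemma Metric_space_rough_paths:
  "Metric_space (rough_paths T \<alpha> :: ('d::finite) rpath set) (rough_dist T \<alpha>)"
proof
  fix Y Z :: "'d rpath"
  show "0 \<le> rough_dist T \<alpha> Y Z" by (simp add: rough_dist_def)
  show "rough_dist T \<alpha> Y Z = rough_dist T \<alpha> Z Y"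
    by (simp add: rough_dist_def hoelder_seminorm_def norm_minus_commute)
next
  have fin: "hoelder_seminorm T \<alpha> (\<lambda>s t. incr (fst Y) s t - incr (fst Z) s t) < \<infinity>"
    "hoelder_seminorm T (2 * \<alpha>) (\<lambda>s t. snd Y s t - snd Z s t) < \<infinity>"
    if "Y \<in> rough_paths T \<alpha>" "Z \<in> rough_paths T \<alpha>" for Y Z :: "'d rpath"
  proof -
    from that have 1: "hoelder_seminorm T \<alpha> (incr (fst Y)) + hoelder_seminorm T \<alpha> (incr (fst Z)) < \<infinity>"
      and 2: "hoelder_seminorm T (2 * \<alpha>) (snd Y) + hoelder_seminorm T (2 * \<alpha>) (snd Z) < \<infinity>"
      by (auto simp: rough_paths_def)
    show "hoelder_seminorm T \<alpha> (\<lambda>s t. incr (fst Y) s t - incr (fst Z) s t) < \<infinity>"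
      by (rule le_less_trans[OF _ 1], intro hoelder_seminorm_triangle norm_triangle_ineq4)
    show "hoelder_seminorm T (2 * \<alpha>) (\<lambda>s t. snd Y s t - snd Z s t) < \<infinity>"
      by (rule le_less_trans[OF _ 2], intro hoelder_seminorm_triangle norm_triangle_ineq4)
  qed
  fix Y Z :: "'d rpath" assume Y: "Y \<in> rough_paths T \<alpha>" and Z: "Z \<in> (rough_paths T \<alpha> :: 'd rpath set)"
  show "rough_dist T \<alpha> Y Z = 0 \<longleftrightarrow> Y = Z"
  proof
    assume "rough_dist T \<alpha> Y Z = 0"
    then have "hoelder_seminorm T \<alpha> (\<lambda>s t. incr (fst Y) s t - incr (fst Z) s t) = 0"
      "hoelder_seminorm T (2 * \<alpha>) (\<lambda>s t. snd Y s t - snd Z s t) = 0"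
      using fin[OF Y Z] by (auto simp: rough_dist_def enn2real_eq_0_iff)
    then have 1: "\<And>s t. 0 \<le> s \<Longrightarrow> s < t \<Longrightarrow> t \<le> T \<Longrightarrow> incr (fst Y) s t = incr (fst Z) s t"
      and 2: "\<And>s t. 0 \<le> s \<Longrightarrow> s < t \<Longrightarrow> t \<le> T \<Longrightarrow> snd Y s t = snd Z s t"
      by (auto simp: hoelder_seminorm_eq_0_iff)
    have "fst Y t = fst Z t" for t
      using 1[of 0 t] Y Z
      by (cases "t = 0"; cases "t \<in> {0..T}") (auto simp: rough_paths_def incr_def)
    moreover have "snd Y s t = snd Z s t" for s t
      using 2[of s t] Y Z rough_paths_diag[OF Y] rough_paths_diag[OF Z]
      by (cases "s = t"; cases "0 \<le> s \<and> s \<le> t \<and> t \<le> T") (auto simp: rough_paths_def)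
    ultimately show "Y = Z" by (simp add: prod_eq_iff fun_eq_iff)
  next
    assume "Y = Z"
    have "hoelder_seminorm T \<beta> (\<lambda>s t. 0 :: 'e::real_normed_vector) = 0" for \<beta>
      by (simp add: hoelder_seminorm_eq_0_iff)
    with \<open>Y = Z\<close> show "rough_dist T \<alpha> Y Z = 0"
      by (simp add: rough_dist_def hoelder_seminorm_eq_0_iff[THEN iffD2])
  qed
  fix W :: "'d rpath" assume W: "W \<in> (rough_paths T \<alpha> :: 'd rpath set)"
  have tri: "norm (a - c) \<le> norm (a - b) + norm (b - c)" for a b c :: "'e::real_normed_vector"
    using norm_triangle_ineq[of "a - b" "b - c"] by simp
  have "hoelder_seminorm T \<alpha> (\<lambda>s t. incr (fst Y) s t - incr (fst W) s t) +
        hoelder_seminorm T (2 * \<alpha>) (\<lambda>s t. snd Y s t - snd W s t)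
     \<le> (hoelder_seminorm T \<alpha> (\<lambda>s t. incr (fst Y) s t - incr (fst Z) s t) +
        hoelder_seminorm T \<alpha> (\<lambda>s t. incr (fst Z) s t - incr (fst W) s t)) +
       (hoelder_seminorm T (2 * \<alpha>) (\<lambda>s t. snd Y s t - snd Z s t) +
        hoelder_seminorm T (2 * \<alpha>) (\<lambda>s t. snd Z s t - snd W s t))"
    by (intro add_mono hoelder_seminorm_triangle tri)
  then show "rough_dist T \<alpha> Y W \<le> rough_dist T \<alpha> Y Z + rough_dist T \<alpha> Z W"
    unfolding rough_dist_def
    using fin[OF Y Z] fin[OF Z W]
    by (subst enn2real_plus[symmetric]) (auto intro!: enn2real_mono simp: algebra_simps)
qed

definition rough_path_metric :: "real \<Rightarrow> real \<Rightarrow> ('d::finite) rpath metric" where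
  "rough_path_metric T \<alpha> = metric (rough_paths T \<alpha>, rough_dist T \<alpha>)"

lemma mspace_rough_path_metric [simp]: "mspace (rough_path_metric T \<alpha>) = rough_paths T \<alpha>"
  and mdist_rough_path_metric [simp]: "mdist (rough_path_metric T \<alpha>) = rough_dist T \<alpha>"
  by (simp_all add: rough_path_metric_def Metric_space.mspace_metric Metric_space.mdist_metric
      Metric_space_rough_paths)

definition polish_rough_path_space :: "real \<Rightarrow> real \<Rightarrow> ('d::finite) rpath metric \<Rightarrow> bool" where
  "polish_rough_path_space T \<alpha> \<C> \<longleftrightarrow>
     mcomplete_of \<C> \<and> separable_space (mtopology_of \<C>) \<and>
     mspace \<C> \<subseteq> rough_paths T \<alpha> \<and>
     continuous_map (mtopology_of \<C>) (mtopology_of (rough_path_metric T \<alpha>)) (\<lambda>Y. Y)"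

definition borel_of_metric :: "'c metric \<Rightarrow> 'c measure" where
  "borel_of_metric \<C> = sigma (mspace \<C>) {U. openin (mtopology_of \<C>) U}"

definition rp_value :: "('d::finite) rpath \<Rightarrow> real \<Rightarrow> (real ^ 'd) \<times> 'd tensor2" where
  "rp_value Y t = (incr (fst Y) 0 t, snd Y 0 t)"


section \<open>Stochastic integrals\<close>

definition partition_of :: "real \<Rightarrow> nat \<Rightarrow> (nat \<Rightarrow> real) \<Rightarrow> bool" where
  "partition_of t n u \<longleftrightarrow> u 0 = 0 \<and> u n = t \<and> (\<forall>i<n. u i < u (Suc i))"

definition brownian_motion ::
  "real \<Rightarrow> 'a measure \<Rightarrow> (real \<Rightarrow> 'a measure) \<Rightarrow> (real \<Rightarrow> 'a \<Rightarrow> real ^ 'b) \<Rightarrow> bool" where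
  "brownian_motion T M \<FF> B \<longleftrightarrow>
     adapted T \<FF> B \<and>
     (AE \<omega> in M. B 0 \<omega> = 0 \<and> continuous_on {0..T} (\<lambda>t. B t \<omega>)) \<and>
     (\<forall>s t. 0 \<le> s \<and> s < t \<and> t \<le> T \<longrightarrow>
        prob_space.indep_set M (sets (\<FF> s))
          (sets (vimage_algebra (space M) (\<lambda>\<omega>. B t \<omega> - B s \<omega>) borel)) \<and>
        distributed M lborel (\<lambda>\<omega>. B t \<omega> - B s \<omega>)
          (\<lambda>x. ennreal (\<Prod>i\<in>UNIV. normal_density 0 (sqrt (t - s)) (x $ i))))"

text \<open>
  The Ito integral of a progressively measurable integrand with square-integrable paths,
  as the limit, uniformly on \<open>[0,T]\<close> in probability, of integrals of bounded simple
  integrands \<open>H = \<Sum>i<n. 1\<^bsub>(u i, u (i+1)]\<^esub> \<xi> i\<close>.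
\<close>

definition simple_integrand ::
  "real \<Rightarrow> 'a measure \<Rightarrow> (real \<Rightarrow> 'a measure) \<Rightarrow> nat \<Rightarrow> (nat \<Rightarrow> real) \<Rightarrow>
   (nat \<Rightarrow> 'a \<Rightarrow> real ^ 'b ^ 'n) \<Rightarrow> bool" where
  "simple_integrand T M \<FF> n u \<xi> \<longleftrightarrow>
     partition_of T n u \<and>
     (\<forall>i<n. \<xi> i \<in> borel_measurable (\<FF> (u i)) \<and> bounded (\<xi> i ` space M))"

definition simple_process ::
  "nat \<Rightarrow> (nat \<Rightarrow> real) \<Rightarrow> (nat \<Rightarrow> 'a \<Rightarrow> real ^ 'b ^ 'n) \<Rightarrow> real \<Rightarrow> 'a \<Rightarrow> real ^ 'b ^ 'n" where
  "simple_process n u \<xi> s \<omega> = (\<Sum>i<n. indicator {u i<..u (Suc i)} s *\<^sub>R \<xi> i \<omega>)"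

definition simple_integral ::
  "(real \<Rightarrow> 'a \<Rightarrow> real ^ 'b) \<Rightarrow> nat \<Rightarrow> (nat \<Rightarrow> real) \<Rightarrow> (nat \<Rightarrow> 'a \<Rightarrow> real ^ 'b ^ 'n) \<Rightarrow>
   real \<Rightarrow> 'a \<Rightarrow> real ^ 'n" where
  "simple_integral B n u \<xi> t \<omega> =
     (\<Sum>i<n. \<xi> i \<omega> *v (B (min t (u (Suc i))) \<omega> - B (min t (u i)) \<omega>))"

definition is_ito_integral ::
  "real \<Rightarrow> 'a measure \<Rightarrow> (real \<Rightarrow> 'a measure) \<Rightarrow> (real \<Rightarrow> 'a \<Rightarrow> real ^ 'b) \<Rightarrow>
   (real \<Rightarrow> 'a \<Rightarrow> real ^ 'b ^ 'n) \<Rightarrow> (real \<Rightarrow> 'a \<Rightarrow> real ^ 'n) \<Rightarrow> bool" where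
  "is_ito_integral T M \<FF> B Sg I \<longleftrightarrow>
     continuous_adapted T M \<FF> I \<and>
     (\<exists>n u \<xi>.
        (\<forall>k. simple_integrand T M \<FF> (n k) (u k) (\<xi> k)) \<and>
        (\<forall>\<epsilon>>0. (\<lambda>k. measure M {\<omega> \<in> space M.
            (\<integral>\<^sup>+s\<in>{0..T}. ennreal ((norm (simple_process (n k) (u k) (\<xi> k) s \<omega> - Sg s \<omega>))\<^sup>2) \<partial>lborel)
              > ennreal \<epsilon>}) \<longlonglongrightarrow> 0) \<and>
        (\<forall>\<epsilon>>0. (\<lambda>k. measure M {\<omega> \<in> space M.
            \<exists>t\<in>{0..T}. norm (simple_integral B (n k) (u k) (\<xi> k) t \<omega> - I t \<omega>) > \<epsilon>}) \<longlonglongrightarrow> 0))"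

definition rough_riemann_sum ::
  "('d::finite) rpath \<Rightarrow> (real \<Rightarrow> 'a \<Rightarrow> real ^ 'd ^ 'n) \<Rightarrow> (real \<Rightarrow> 'a \<Rightarrow> real ^ 'd ^ 'd ^ 'n) \<Rightarrow>
   nat \<Rightarrow> (nat \<Rightarrow> real) \<Rightarrow> 'a \<Rightarrow> real ^ 'n" where
  "rough_riemann_sum Y F F' n u \<omega> =
     (\<Sum>i<n. F (u i) \<omega> *v incr (fst Y) (u i) (u (Suc i)) +
             tensor_apply (F' (u i) \<omega>) (snd Y (u i) (u (Suc i))))"

definition is_rough_integral ::
  "real \<Rightarrow> real \<Rightarrow> 'a measure \<Rightarrow> (real \<Rightarrow> 'a measure) \<Rightarrow> ('d::finite) rpath \<Rightarrow>
   (real \<Rightarrow> 'a \<Rightarrow> real ^ 'd ^ 'n) \<Rightarrow> (real \<Rightarrow> 'a \<Rightarrow> real ^ 'd ^ 'd ^ 'n) \<Rightarrow>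
   (real \<Rightarrow> 'a \<Rightarrow> real ^ 'n) \<Rightarrow> bool" where
  "is_rough_integral T p M \<FF> Y F F' J \<longleftrightarrow>
     continuous_adapted T M \<FF> J \<and>
     (\<forall>t\<in>{0..T}. \<forall>\<epsilon>>0. \<exists>\<delta>>0. \<forall>n u.
        partition_of t n u \<and> (\<forall>i<n. u (Suc i) - u i < \<delta>) \<longrightarrow>
        Lp_norm M p (\<lambda>\<omega>. rough_riemann_sum Y F F' n u \<omega> - J t \<omega>) < ennreal \<epsilon>)"


section \<open>Rough Ito processes\<close>

definition hoelder_Lp_norm ::
  "real \<Rightarrow> 'a measure \<Rightarrow> real \<Rightarrow> real \<Rightarrow> (real \<Rightarrow> 'a \<Rightarrow> 'e::real_normed_vector) \<Rightarrow> ennreal" where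
  "hoelder_Lp_norm T M \<alpha> p G =
     (SUP t\<in>{0..T}. Lp_norm M p (G t)) +
     (SUP (s, t) \<in> {(s, t). 0 \<le> s \<and> s < t \<and> t \<le> T}.
        Lp_norm M p (\<lambda>\<omega>. G t \<omega> - G s \<omega>) / ennreal ((t - s) powr \<alpha>))"

definition cond_remainder_norm ::
  "real \<Rightarrow> 'a measure \<Rightarrow> (real \<Rightarrow> 'a measure) \<Rightarrow> real \<Rightarrow> real \<Rightarrow>
   (real \<Rightarrow> real \<Rightarrow> 'a \<Rightarrow> 'e::euclidean_space) \<Rightarrow> ennreal" where
  "cond_remainder_norm T M \<FF> \<beta> p R =
     (SUP (s, t) \<in> {(s, t). 0 \<le> s \<and> s < t \<and> t \<le> T}.
        Lp_norm M p (vec_cond_exp M (\<FF> s) (R s t)) / ennreal ((t - s) powr \<beta>))"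

definition remainder ::
  "('d::finite) rpath \<Rightarrow> (real \<Rightarrow> 'a \<Rightarrow> real ^ 'd ^ 'n) \<Rightarrow> (real \<Rightarrow> 'a \<Rightarrow> real ^ 'd ^ 'd ^ 'n) \<Rightarrow>
   real \<Rightarrow> real \<Rightarrow> 'a \<Rightarrow> real ^ 'd ^ 'n" where
  "remainder Y F F' s t \<omega> = F t \<omega> - F s \<omega> - tensor_curry (F' s \<omega>) (incr (fst Y) s t)"

text \<open>Coefficient fields take their arguments in the order rough path, time, \<open>\<omega>\<close>.\<close>

type_synonym ('d, 'a, 'e) field = "'d rpath \<Rightarrow> real \<Rightarrow> 'a \<Rightarrow> 'e"

definition assumption1 ::
  "real \<Rightarrow> real \<Rightarrow> real \<Rightarrow> 'a measure \<Rightarrow> (real \<Rightarrow> 'a measure) \<Rightarrow> ('d::finite) rpath metric \<Rightarrow>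
   ('d, 'a, real ^ 'n) field \<Rightarrow> ('d, 'a, real ^ 'b ^ 'n) field \<Rightarrow>
   ('d, 'a, real ^ 'd ^ 'n) field \<Rightarrow> ('d, 'a, real ^ 'd ^ 'd ^ 'n) field \<Rightarrow> bool" where
  "assumption1 T \<alpha> p M \<FF> \<C> A Sg F F' \<longleftrightarrow>
     (\<forall>Y\<in>mspace \<C>.
        progressively_measurable T \<FF> (A Y) \<and> progressively_measurable T \<FF> (Sg Y) \<and>
        progressively_measurable T \<FF> (F Y) \<and> progressively_measurable T \<FF> (F' Y) \<and>
        (AE \<omega> in M. set_integrable lborel {0..T} (\<lambda>s. A Y s \<omega>) \<and>
           set_integrable lborel {0..T} (\<lambda>s. Sg Y s \<omega> ** transpose (Sg Y s \<omega>))) \<and>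
        hoelder_Lp_norm T M \<alpha> p (F Y) + hoelder_Lp_norm T M \<alpha> p (F' Y) +
          cond_remainder_norm T M \<FF> (2 * \<alpha>) p (remainder Y (F Y) (F' Y)) < \<infinity>)"

text \<open>
  Measurability in \<open>(\<^bold>Y, (t, \<omega>))\<close> with respect to the product of the Borel
  \<open>\<sigma>\<close>-field of the rough path space and a \<open>\<sigma>\<close>-field \<open>\<S>\<close> on \<open>[0,T] \<times> \<Omega>\<close>,
  where \<open>\<S>\<close> is either the optional or the progressive one.
\<close>

definition field_measurable ::
  "('d::finite) rpath metric \<Rightarrow> (real \<times> 'a) measure \<Rightarrow> ('d, 'a, 'e::topological_space) field \<Rightarrow> bool" where
  "field_measurable \<C> \<S> \<Theta> \<longleftrightarrow>
     (\<lambda>(Y, (t, \<omega>)). \<Theta> Y t \<omega>) \<in> borel_measurable (borel_of_metric \<C> \<Otimes>\<^sub>M \<S>)"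

definition assumption2 ::
  "('d::finite) rpath metric \<Rightarrow> (real \<times> 'a) measure \<Rightarrow> (real \<Rightarrow> 'a measure) \<Rightarrow>
   ('d rpath \<Rightarrow> 'a \<Rightarrow> real ^ 'n) \<Rightarrow>
   ('d, 'a, real ^ 'n) field \<Rightarrow> ('d, 'a, real ^ 'b ^ 'n) field \<Rightarrow>
   ('d, 'a, real ^ 'd ^ 'n) field \<Rightarrow> ('d, 'a, real ^ 'd ^ 'd ^ 'n) field \<Rightarrow> bool" where
  "assumption2 \<C> \<S> \<FF> X0 A Sg F F' \<longleftrightarrow>
     field_measurable \<C> \<S> A \<and> field_measurable \<C> \<S> Sg \<and>
     field_measurable \<C> \<S> F \<and> field_measurable \<C> \<S> F' \<and>
     (\<lambda>(Y, \<omega>). X0 Y \<omega>) \<in> borel_measurable (borel_of_metric \<C> \<Otimes>\<^sub>M \<FF> 0)"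

definition rough_ito_process ::
  "real \<Rightarrow> real \<Rightarrow> 'a measure \<Rightarrow> (real \<Rightarrow> 'a measure) \<Rightarrow> ('d::finite) rpath metric \<Rightarrow>
   (real \<Rightarrow> 'a \<Rightarrow> real ^ 'b) \<Rightarrow> ('d rpath \<Rightarrow> 'a \<Rightarrow> real ^ 'n) \<Rightarrow>
   ('d, 'a, real ^ 'n) field \<Rightarrow> ('d, 'a, real ^ 'b ^ 'n) field \<Rightarrow>
   ('d, 'a, real ^ 'd ^ 'n) field \<Rightarrow> ('d, 'a, real ^ 'd ^ 'd ^ 'n) field \<Rightarrow>
   ('d, 'a, real ^ 'n) field \<Rightarrow> bool" where
  "rough_ito_process T p M \<FF> \<C> B X0 A Sg F F' X \<longleftrightarrow>
     (\<forall>Y\<in>mspace \<C>.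
        continuous_adapted T M \<FF> (X Y) \<and>
        (\<exists>I J. is_ito_integral T M \<FF> B (Sg Y) I \<and>
           is_rough_integral T p M \<FF> Y (F Y) (F' Y) J \<and>
           (AE \<omega> in M. \<forall>t\<in>{0..T}.
              X Y t \<omega> = X0 Y \<omega> + (LINT s:{0..t}|lborel. A Y s \<omega>) + I t \<omega> + J t \<omega>)))"

definition is_version ::
  "real \<Rightarrow> 'a measure \<Rightarrow> ('d::finite) rpath metric \<Rightarrow>
   ('d, 'a, 'e) field \<Rightarrow> ('d, 'a, 'e) field \<Rightarrow> bool" where
  "is_version T M \<C> X X' \<longleftrightarrow> (\<forall>Y\<in>mspace \<C>. indistinguishable T M (X' Y) (X Y))"

definition randomised :: "('d, 'a, 'e) field \<Rightarrow> ('w \<Rightarrow> 'd rpath) \<Rightarrow> real \<Rightarrow> 'a \<times> 'w \<Rightarrow> 'e" where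
  "randomised X W t = (\<lambda>(\<omega>', \<omega>''). X (W \<omega>'') t \<omega>')"

definition lift1 :: "'a measure \<Rightarrow> 'w measure \<Rightarrow> 'a measure \<Rightarrow> ('a \<times> 'w) measure" where
  "lift1 M N G = vimage_algebra (space M \<times> space N) fst G"

definition lift2 :: "'a measure \<Rightarrow> 'w measure \<Rightarrow> 'w measure \<Rightarrow> ('a \<times> 'w) measure" where
  "lift2 M N G = vimage_algebra (space M \<times> space N) snd G"

end

theory Submission
  imports Defs
begin

text \<open>
  Everything rests on the joint measurability of \<open>(\<omega>', \<omega>'') \<mapsto> X (W \<omega>'') t \<omega>'\<close> and on Fubini's
  theorem.  For (iii), almost sure continuity of \<open>X Y\<close> for each fixed \<open>Y\<close> is integrated over
  \<open>Y = W \<omega>''\<close>: agreement with a continuous process obtained by extension from a countable dense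
  set of times is a measurable event at each time, and it has probability one in \<open>\<omega>'\<close> for
  every \<open>\<omega>''\<close>.
\<close>

section \<open>Continuous extension from a countable dense set of times\<close>

text \<open>By the Archimedean property nothing is lost when both tolerances run through a sequence.
  Over a countable \<open>D\<close> only countable quantifiers remain, so uniform continuity of the
  paths of a process becomes a measurable event.\<close>

lemma uniformly_continuous_on_iff_inverse_Suc:
  "uniformly_continuous_on D f \<longleftrightarrow>
     (\<forall>n::nat. \<exists>m::nat. \<forall>x\<in>D. \<forall>y\<in>D.
        dist x y < inverse (real (Suc m)) \<longrightarrow> dist (f x) (f y) < inverse (real (Suc n)))"
    (is "?L \<longleftrightarrow> ?R")
proof
  assume L: ?L
  show ?R
  proof
    fix n :: nat
    obtain d where d: "d > 0" "\<forall>x\<in>D. \<forall>y\<in>D. dist y x < d \<longrightarrow> dist (f y) (f x) < inverse (real (Suc n))"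
      using L unfolding uniformly_continuous_on_def by (meson inverse_Suc)
    obtain m where "inverse (real (Suc m)) < d"
      using reals_Archimedean[OF d(1)] by blast
    with d(2) show "\<exists>m::nat. \<forall>x\<in>D. \<forall>y\<in>D.
        dist x y < inverse (real (Suc m)) \<longrightarrow> dist (f x) (f y) < inverse (real (Suc n))"
      by (intro exI[of _ m]) force
  qed
next
  assume R: ?R
  show ?L
    unfolding uniformly_continuous_on_def
  proof (intro allI impI)
    fix e :: real assume "e > 0"
    then obtain n where n: "inverse (real (Suc n)) < e"
      using reals_Archimedean by blast
    obtain m where m: "\<forall>x\<in>D. \<forall>y\<in>D.
        dist x y < inverse (real (Suc m)) \<longrightarrow> dist (f x) (f y) < inverse (real (Suc n))"
      using R by blast
    show "\<exists>d>0. \<forall>x\<in>D. \<forall>x'\<in>D. dist x' x < d \<longrightarrow> dist (f x') (f x) < e"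
      using m n by (intro exI[of _ "inverse (real (Suc m))"]) (auto intro: less_trans)
  qed
qed

lemma sets_Collect_uniformly_continuous_on:
  fixes Z :: "'t::metric_space \<Rightarrow> 'a \<Rightarrow> 'e::{metric_space, second_countable_topology}"
  assumes D: "countable D" and Z: "\<And>t. t \<in> D \<Longrightarrow> Z t \<in> borel_measurable P"
  shows "{\<omega> \<in> space P. uniformly_continuous_on D (\<lambda>t. Z t \<omega>)} \<in> sets P"
  unfolding uniformly_continuous_on_iff_inverse_Suc
proof (intro sets.sets_Collect_countable_All sets.sets_Collect_countable_Ex
    sets.sets_Collect_countable_All' D)
  fix n m :: nat and x y assume "x \<in> D" "y \<in> D"
  note [measurable] = Z[OF this(1)] Z[OF this(2)]
  show "{\<omega> \<in> space P. dist x y < inverse (real (Suc m)) \<longrightarrow>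
      dist (Z x \<omega>) (Z y \<omega>) < inverse (real (Suc n))} \<in> sets P"
    by measurable
qed

text \<open>Continuity on all of \<open>K\<close> involves possibly uncountably many times and need
  not be a measurable event, but uniform continuity on a countable dense \<open>D\<close> is one. On
  that event the path extends continuously from \<open>D\<close> to \<open>K\<close>, by
  completeness of the codomain; compactness of \<open>K\<close> puts every continuous path of
  \<open>X\<close> into the event.\<close>

lemma continuous_process_extension:
  fixes X :: "'t::{metric_space, second_countable_topology} \<Rightarrow> 'a \<Rightarrow>
    'e::{real_normed_vector, complete_space, second_countable_topology}"
  assumes K: "compact K" and X: "\<And>t. t \<in> K \<Longrightarrow> X t \<in> borel_measurable P"
  obtains Z where "\<And>t. t \<in> K \<Longrightarrow> Z t \<in> borel_measurable P"
    "\<And>\<omega>. continuous_on K (\<lambda>t. Z t \<omega>)"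
    "\<And>\<omega> t. \<omega> \<in> space P \<Longrightarrow> continuous_on K (\<lambda>t. X t \<omega>) \<Longrightarrow> t \<in> K \<Longrightarrow> Z t \<omega> = X t \<omega>"
proof -
  obtain D where D: "countable D" "D \<subseteq> K" "K \<subseteq> closure D"
    using separable by blast
  have closure: "closure D = K"
    using D K by (simp add: closure_minimal compact_imp_closed subset_antisym)
  define G where "G = {\<omega> \<in> space P. uniformly_continuous_on D (\<lambda>t. X t \<omega>)}"
  have [measurable]: "G \<in> sets P"
    unfolding G_def using D X by (intro sets_Collect_uniformly_continuous_on) auto
  have "\<exists>g. continuous_on K g \<and> (\<forall>t\<in>D. g t = X t \<omega>)" if "\<omega> \<in> G" for \<omega>
  proof -
    have "uniformly_continuous_on D (\<lambda>t. X t \<omega>)"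
      using that by (simp add: G_def)
    then obtain g where "uniformly_continuous_on (closure D) g" "\<And>x. x \<in> D \<Longrightarrow> X x \<omega> = g x"
      by (rule uniformly_continuous_on_extension_on_closure) blast
    then show ?thesis
      by (metis closure uniformly_continuous_imp_continuous)
  qed
  \<comment> \<open>The extensions are chosen separately for each \<omega>, so \<open>g\<close>
    carries no measurability in \<omega>; that of \<open>Z\<close> is recovered below from limits
    along \<open>D\<close>.\<close>
  then obtain g where g: "\<And>\<omega>. \<omega> \<in> G \<Longrightarrow> continuous_on K (g \<omega>)"
    "\<And>\<omega> t. \<omega> \<in> G \<Longrightarrow> t \<in> D \<Longrightarrow> g \<omega> t = X t \<omega>"
    by metis
  \<comment> \<open>The zero path off \<open>G\<close> makes \<open>Z\<close> continuous for every
    \<omega>. On \<open>G\<close>, \<open>Z\<close> may still differ from \<open>X\<close> at times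
    outside \<open>D\<close>.\<close>
  define Z where "Z t \<omega> = (if \<omega> \<in> G then g \<omega> t else 0)" for t \<omega>
  show thesis
  proof
    show "continuous_on K (\<lambda>t. Z t \<omega>)" for \<omega>
      using g(1) by (cases "\<omega> \<in> G") (auto simp: Z_def)
    show "Z t \<in> borel_measurable P" if t: "t \<in> K" for t
    proof -
      \<comment> \<open>On \<open>G\<close> the extension agrees with \<open>X\<close> along
        \<open>q\<close>, so \<open>Z t\<close> is a pointwise limit of measurable functions;
        cutting these off outside \<open>G\<close> makes them converge everywhere.\<close>
      obtain q where q: "\<And>n. q n \<in> D" "q \<longlonglongrightarrow> t"
        using t closure closure_sequential[of t D] by auto
      have [measurable]: "X (q n) \<in> borel_measurable P" for n
        using q(1) D(2) X by blast
      show ?thesis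
      proof (rule borel_measurable_LIMSEQ_metric)
        show "(\<lambda>\<omega>. if \<omega> \<in> G then X (q n) \<omega> else 0) \<in> borel_measurable P" for n
          by measurable
        show "(\<lambda>n. if \<omega> \<in> G then X (q n) \<omega> else 0) \<longlonglongrightarrow> Z t \<omega>" for \<omega>
        proof (cases "\<omega> \<in> G")
          case True
          then have "(\<lambda>n. g \<omega> (q n)) \<longlonglongrightarrow> g \<omega> t"
            using continuous_on_tendsto_compose[OF g(1)[OF True] q(2) t] q(1) D(2)
            by (auto intro: always_eventually)
          with True show ?thesis
            by (simp add: Z_def g(2) q(1))
        qed (simp add: Z_def)
      qed
    qed
    show "Z t \<omega> = X t \<omega>"
      if \<omega>: "\<omega> \<in> space P" and X_cont: "continuous_on K (\<lambda>t. X t \<omega>)" and t: "t \<in> K" for \<omega> t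
    proof -
      have "uniformly_continuous_on D (\<lambda>t. X t \<omega>)"
        using compact_uniformly_continuous[OF X_cont K] D(2) unfolding uniformly_continuous_on_def
        by (elim all_forward imp_forward ex_forward conj_forward) blast+
      then have G: "\<omega> \<in> G"
        using \<omega> by (simp add: G_def)
      \<comment> \<open>The difference of the two paths is continuous on \<open>K\<close> and
        vanishes on the dense set \<open>D\<close>, hence on all of \<open>K\<close>.\<close>
      have "g \<omega> t = X t \<omega>"
        using continuous_constant_on_closure[of D "\<lambda>t. g \<omega> t - X t \<omega>" 0 t] g[OF G] t
          continuous_on_diff[OF g(1)[OF G] X_cont]
        by (simp add: closure)
      with G show ?thesis
        by (simp add: Z_def)
    qed
  qed
qed

text \<open>The event that a whole path is continuous need not be measurable in the product, so
  Fubini's theorem is not applied to it. It is applied, at each fixed time, to the event that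
  \<open>X t\<close> and the extension \<open>Z t\<close> agree, which is measurable and has full
  probability in every section. The exceptional null set may depend on \<open>t\<close>, whence a
  modification.\<close>

lemma continuous_modification_of_ae_continuous_sections:
  fixes X :: "real \<Rightarrow> 'a \<times> 'w \<Rightarrow> 'e::{real_normed_vector, complete_space, second_countable_topology}"
  assumes "prob_space M" "prob_space N"
    and X: "\<And>t. t \<in> {0..T} \<Longrightarrow> X t \<in> borel_measurable (M \<Otimes>\<^sub>M N)"
    and cont: "\<And>y. y \<in> space N \<Longrightarrow> AE x in M. continuous_on {0..T} (\<lambda>t. X t (x, y))"
  shows "\<exists>Z. continuous_modification T (completion (M \<Otimes>\<^sub>M N)) X Z"
proof -
  interpret M: prob_space M by fact
  interpret N: prob_space N by fact
  interpret pair_prob_space M N ..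
  obtain Z where Z: "\<And>t. t \<in> {0..T} \<Longrightarrow> Z t \<in> borel_measurable (M \<Otimes>\<^sub>M N)"
    "\<And>\<omega>. continuous_on {0..T} (\<lambda>t. Z t \<omega>)"
    "\<And>\<omega> t. \<omega> \<in> space (M \<Otimes>\<^sub>M N) \<Longrightarrow> continuous_on {0..T} (\<lambda>t. X t \<omega>) \<Longrightarrow> t \<in> {0..T} \<Longrightarrow> Z t \<omega> = X t \<omega>"
    using continuous_process_extension[of "{0..T}" X "M \<Otimes>\<^sub>M N"] X by auto
  have "AE \<omega> in M \<Otimes>\<^sub>M N. Z t \<omega> = X t \<omega>" if t: "t \<in> {0..T}" for t
  proof -
    note [measurable] = X[OF t] Z(1)[OF t]
    have meas: "{\<omega> \<in> space (M \<Otimes>\<^sub>M N). Z t \<omega> = X t \<omega>} \<in> sets (M \<Otimes>\<^sub>M N)"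
      by measurable
    have "AE y in N. AE x in M. Z t (x, y) = X t (x, y)"
    proof (rule AE_I2)
      fix y assume y: "y \<in> space N"
      show "AE x in M. Z t (x, y) = X t (x, y)"
        using cont[OF y] AE_space
        by eventually_elim (use y t in \<open>auto intro!: Z(3) simp: space_pair_measure\<close>)
    qed
    \<comment> \<open>Continuity is known section by section in \<open>y\<close>, whereas
      \<open>AE_pair_measure\<close> quantifies over \<open>x\<close> first; measurability of the
      event allows the swap.\<close>
    then have "AE x in M. AE y in N. Z t (x, y) = X t (x, y)"
      using AE_commute[of "\<lambda>x y. Z t (x, y) = X t (x, y)"] meas by simp
    then show ?thesis
      by (rule AE_pair_measure[OF meas])
  qed
  then show ?thesis
    unfolding continuous_modification_def using Z(1,2)
    by (intro exI[of _ Z]) (auto intro: AE_completion measurable_completion)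
qed

section \<open>Product and lifted \<sigma>-fields\<close>

lemma measurable_pair_subalgebra:
  assumes f: "f \<in> N1 \<Otimes>\<^sub>M N2 \<rightarrow>\<^sub>M K" and "subalgebra M1 N1" "subalgebra M2 N2"
  shows "f \<in> M1 \<Otimes>\<^sub>M M2 \<rightarrow>\<^sub>M K"
proof -
  have [measurable]: "(\<lambda>x. x) \<in> M1 \<rightarrow>\<^sub>M N1" "(\<lambda>x. x) \<in> M2 \<rightarrow>\<^sub>M N2"
    using assms(2,3) by (auto simp: subalgebra_def measurable_def)
  have "(\<lambda>\<omega>. (fst \<omega>, snd \<omega>)) \<in> M1 \<Otimes>\<^sub>M M2 \<rightarrow>\<^sub>M N1 \<Otimes>\<^sub>M N2"
    by measurable
  from measurable_compose[OF this f] show ?thesis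
    by simp
qed

lemma space_lift2: "space (lift2 M N G) = space M \<times> space N"
  by (simp add: lift2_def)

lemma measurable_snd_lift2: "space G = space N \<Longrightarrow> snd \<in> lift2 M N G \<rightarrow>\<^sub>M G"
  unfolding lift2_def by (rule measurable_vimage_algebra1) (simp add: Pi_def)

text \<open>Preimages commute with countable set operations, so the cylinders already form a
  \<sigma>-field. This form is needed to test a conditional expectation on every set of the lifted
  \<sigma>-field.\<close>

lemma sets_lift2:
  assumes "space G = space N"
  shows "sets (lift2 M N G) = {space M \<times> A | A. A \<in> sets G}"
proof -
  have "snd -` A \<inter> space M \<times> space N = space M \<times> A" if "A \<in> sets G" for A
    using sets.sets_into_space[OF that] assms by auto
  then have "(\<lambda>A. snd -` A \<inter> space M \<times> space N) ` sets G = (\<lambda>A. space M \<times> A) ` sets G"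
    by (rule image_cong[OF refl])
  moreover have "snd \<in> space M \<times> space N \<rightarrow> space G"
    by (simp add: assms Pi_def)
  ultimately show ?thesis
    by (simp add: lift2_def sets_vimage_algebra2 setcompr_eq_image)
qed

lemma subalgebra_lift2:
  assumes "subalgebra N G"
  shows "subalgebra (M \<Otimes>\<^sub>M N) (lift2 M N G)"
proof -
  have "space G = space N" "sets G \<subseteq> sets N"
    using assms by (auto simp: subalgebra_def)
  then show ?thesis
    unfolding subalgebra_def
    by (auto simp: space_lift2 space_pair_measure sets_lift2)
qed

text \<open>The join contains both lifts, so both coordinate projections are measurable. It turns
  measurability on a product \<sigma>-field into the adaptedness asserted in (i).\<close>

lemma measurable_join_lift:
  assumes "space G = space M" "space H = space N"
  shows "(\<lambda>\<omega>. \<omega>) \<in> join_sigma (lift1 M N G) (lift2 M N H) \<rightarrow>\<^sub>M G \<Otimes>\<^sub>M H"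
proof -
  let ?J = "join_sigma (lift1 M N G) (lift2 M N H)"
  have space: "space ?J = space M \<times> space N" "space (lift1 M N G) = space M \<times> space N"
    "space (lift2 M N H) = space M \<times> space N"
    by (simp_all add: join_sigma_def lift1_def space_lift2 space_measure_of_conv)
  have "sets (lift1 M N G) \<union> sets (lift2 M N H) \<subseteq> Pow (space M \<times> space N)"
    using sets.space_closed[of "lift1 M N G"] sets.space_closed[of "lift2 M N H"] space by auto
  then have sets: "sets (lift1 M N G) \<subseteq> sets ?J" "sets (lift2 M N H) \<subseteq> sets ?J"
    by (auto simp: join_sigma_def space)
  have "fst \<in> lift1 M N G \<rightarrow>\<^sub>M G" "snd \<in> lift2 M N H \<rightarrow>\<^sub>M H"
    using assms by (auto simp: lift1_def intro!: measurable_vimage_algebra1 measurable_snd_lift2)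
  then have "fst \<in> ?J \<rightarrow>\<^sub>M G" "snd \<in> ?J \<rightarrow>\<^sub>M H"
    using sets space by (auto simp: measurable_def)
  then show ?thesis
    by (intro measurable_pair) (simp_all add: comp_def)
qed

section \<open>Conditional laws on a product space\<close>

text \<open>This is the freezing principle: under the product measure the first coordinate is
  independent of \<open>G\<close>, while \<open>f\<close> depends on the second one only through
  \<open>G\<close>. Conditioning therefore fixes the second coordinate and integrates out the
  first.\<close>

lemma regular_conditional_distribution_pair:
  fixes f :: "'a \<times> 'w \<Rightarrow> 'e::topological_space"
  assumes "prob_space M" "prob_space N" and G: "subalgebra N G"
    and f [measurable]: "f \<in> borel_measurable (M \<Otimes>\<^sub>M G)"
  shows "regular_conditional_distribution (completion (M \<Otimes>\<^sub>M N)) (lift2 M N G) f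
    (\<lambda>\<omega>. distr M borel (\<lambda>x. f (x, snd \<omega>)))"
proof -
  interpret M: prob_space M by fact
  interpret N: prob_space N by fact
  interpret pair_prob_space M N ..
  let ?P = "M \<Otimes>\<^sub>M N" and ?L = "lift2 M N G"
  have spG: "space G = space N"
    using G by (simp add: subalgebra_def)
  interpret C: prob_space "completion ?P"
    by (rule prob_spaceI) (simp add: emeasure_space_1)
  have LP: "subalgebra ?P ?L"
    by (rule subalgebra_lift2[OF G])
  then have L: "subalgebra (completion ?P) ?L"
    by (auto simp: subalgebra_def)
  interpret C: finite_measure_subalgebra "completion ?P" ?L
    by unfold_locales (rule L)
  have f' [measurable]: "f \<in> borel_measurable ?P"
    by (rule measurable_pair_subalgebra[OF f _ G]) (simp add: subalgebra_def)
  have slice: "(\<lambda>x. f (x, y)) \<in> borel_measurable M" if "y \<in> space N" for y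
    using that f' by measurable
  have kernel: "(\<lambda>y. distr M borel (\<lambda>x. f (x, y))) \<in> G \<rightarrow>\<^sub>M prob_algebra borel"
    by (rule measurable_distr_prob_space2[where M = M])
      (auto simp: space_prob_algebra M.prob_space_axioms intro!: measurable_const)
  have \<kappa>: "(\<lambda>\<omega>. distr M borel (\<lambda>x. f (x, snd \<omega>))) \<in> ?L \<rightarrow>\<^sub>M prob_algebra borel"
    using measurable_compose[OF measurable_snd_lift2[OF spG] kernel] .
  have "AE \<omega> in completion ?P. real_cond_exp (completion ?P) ?L (\<lambda>\<omega>. indicator D (f \<omega>)) \<omega> =
      measure (distr M borel (\<lambda>x. f (x, snd \<omega>))) D" (is "AE \<omega> in _. _ = ?k \<omega>")
    if D [measurable]: "D \<in> sets borel" for D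
  proof (rule C.real_cond_exp_charact)
    let ?m = "\<lambda>y. measure (distr M borel (\<lambda>x. f (x, y))) D"
    show k: "?k \<in> borel_measurable ?L"
      using \<kappa> by measurable
    have k' [measurable]: "?k \<in> borel_measurable ?P"
      using measurable_from_subalg[OF LP k] .
    have k_le: "?m y \<le> 1" if "y \<in> space N" for y
      using prob_space.prob_le_1[OF M.prob_space_distr[OF slice[OF that]]] by simp
    show "integrable (completion ?P) (\<lambda>\<omega>. indicator D (f \<omega>) :: real)"
      by (rule C.integrable_const_bound[of _ 1]) (auto intro!: measurable_completion)
    show "integrable (completion ?P) ?k"
      by (rule C.integrable_const_bound[of _ 1])
        (auto simp: k_le space_pair_measure intro!: AE_I2 measurable_completion)
    fix A assume "A \<in> sets ?L"
    then obtain E where E: "A = space M \<times> E" "E \<in> sets G"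
      unfolding sets_lift2[OF spG] by auto
    then have [measurable]: "E \<in> sets N"
      using G by (auto simp: subalgebra_def)
    show "(\<integral>\<omega>\<in>A. indicator D (f \<omega>) \<partial>completion ?P) = (\<integral>\<omega>\<in>A. ?k \<omega> \<partial>completion ?P)"
    proof -
      \<comment> \<open>A cylinder constrains the second coordinate only, so its indicator is
        constant in the inner integral over \<open>x\<close>.\<close>
      have A: "indicator A \<omega> = (indicator E (snd \<omega>) :: real)" if "\<omega> \<in> space ?P" for \<omega>
        using that by (auto simp: E(1) space_pair_measure split: split_indicator)
      have [measurable]: "A \<in> sets ?P"
        by (simp add: E(1))
      have k_eq: "?m y = (\<integral>x. indicator D (f (x, y)) \<partial>M)" if "y \<in> space N" for y
      proof -
        note [measurable] = slice[OF that]
        have "measure (distr M borel (\<lambda>x. f (x, y))) D = (\<integral>z. indicator D z \<partial>distr M borel (\<lambda>x. f (x, y)))"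
          by simp
        also have "\<dots> = (\<integral>x. indicator D (f (x, y)) \<partial>M)"
          by (rule integral_distr) auto
        finally show ?thesis
          by simp
      qed
      \<comment> \<open>The integrands are measurable for the uncompleted product, so the integrals
        can be computed there with Fubini's theorem.\<close>
      have "(\<integral>\<omega>\<in>A. indicator D (f \<omega>) \<partial>completion ?P) =
          (\<integral>(x, y). indicator E y * indicator D (f (x, y)) \<partial>?P :: real)"
        unfolding set_lebesgue_integral_def
        by (subst integral_completion) (auto intro!: Bochner_Integration.integral_cong simp: A)
      also have "\<dots> = (\<integral>y. (\<integral>x. indicator E y * indicator D (f (x, y)) \<partial>M) \<partial>N)"
        by (rule integral_snd[symmetric], rule P.integrable_const_bound[of _ 1])
          (auto split: split_indicator)
      \<comment> \<open>The new integrand is constant in \<open>x\<close>. Its integral over the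
        probability measure \<open>M\<close> is kept so that Fubini's theorem can be read backwards
        next.\<close>
      also have "\<dots> = (\<integral>y. (\<integral>x. indicator E y * ?m y \<partial>M) \<partial>N)"
        by (rule Bochner_Integration.integral_cong[OF refl]) (simp add: k_eq M.prob_space)
      also have "\<dots> = (\<integral>(x, y). indicator E y * ?m y \<partial>?P)"
        by (rule integral_snd, rule P.integrable_const_bound[of _ 1])
          (auto simp: k_le space_pair_measure intro!: AE_I2 split: split_indicator)
      also have "\<dots> = (\<integral>\<omega>\<in>A. ?k \<omega> \<partial>completion ?P)"
        unfolding set_lebesgue_integral_def
        by (subst integral_completion) (auto intro!: Bochner_Integration.integral_cong simp: A)
      finally show ?thesis .
    qed
  qed
  then show ?thesis
    unfolding regular_conditional_distribution_def
    using L \<kappa> f' by (simp add: measurable_completion)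
qed

section \<open>Fixed-time sections of the optional and progressive \<sigma>-fields\<close>

text \<open>It suffices to test generators: the section at \<open>t\<close> of a generator is the
  preimage of \<open>D\<close> under \<open>Z t\<close>, an event of \<open>\<FF> t\<close> by
  adaptedness.\<close>

lemma measurable_section_optional_sigma:
  assumes t: "t \<in> {0..T}" and space: "space (\<FF> t) = space M"
  shows "Pair t \<in> \<FF> t \<rightarrow>\<^sub>M optional_sigma T M \<FF>"
  unfolding optional_sigma_def
proof (rule measurable_measure_of, goal_cases)
  case (3 E)
  then obtain Z :: "real \<Rightarrow> 'a \<Rightarrow> real" and D
    where E: "E = {(t, \<omega>) \<in> {0..T} \<times> space M. Z t \<omega> \<in> D}"
      and Z: "adapted T \<FF> Z" and D: "D \<in> sets borel"
    by blast
  have "Pair t -` E \<inter> space (\<FF> t) = Z t -` D \<inter> space (\<FF> t)"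
    using t space by (auto simp: E)
  also have "\<dots> \<in> sets (\<FF> t)"
    using Z t D by (auto simp: adapted_def intro: measurable_sets)
  finally show ?case .
qed (use t space in auto)

lemma measurable_section_progressive_sigma:
  assumes t: "t \<in> {0..T}" and space: "space (\<FF> t) = space M"
  shows "Pair t \<in> \<FF> t \<rightarrow>\<^sub>M progressive_sigma T M \<FF>"
  unfolding progressive_sigma_def
proof (rule measurable_measure_of, goal_cases)
  case (3 E)
  then obtain Z :: "real \<Rightarrow> 'a \<Rightarrow> real" and D
    where E: "E = {(t, \<omega>) \<in> {0..T} \<times> space M. Z t \<omega> \<in> D}"
      and Z: "progressively_measurable T \<FF> Z" and D: "D \<in> sets borel"
    by blast
  have "(\<lambda>(s, \<omega>). Z s \<omega>) \<in> borel_measurable (restrict_space borel {0..t} \<Otimes>\<^sub>M \<FF> t)"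
    using Z t by (auto simp: progressively_measurable_def)
  \<comment> \<open>The time \<open>t\<close> is the right end point of the closed interval
    \<open>{0..t}\<close>, so the section at \<open>t\<close> can be taken inside the domain where
    \<open>Z\<close> is jointly measurable.\<close>
  moreover have "t \<in> space (restrict_space borel {0..t})"
    using t by (simp add: space_restrict_space)
  ultimately have "Z t \<in> borel_measurable (\<FF> t)"
    using measurable_Pair2[of "\<lambda>(s, \<omega>). Z s \<omega>"] by fastforce
  then have "Z t -` D \<inter> space (\<FF> t) \<in> sets (\<FF> t)"
    using D by (rule measurable_sets)
  also have "Z t -` D \<inter> space (\<FF> t) = Pair t -` E \<inter> space (\<FF> t)"
    using t space by (auto simp: E)
  finally show ?case .
qed (use t space in auto)

section \<open>Adaptedness, conditional law and continuity of the randomised process\<close>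

theorem theorem3p6:
  fixes T \<alpha> p :: real
    and M' :: "'a measure" and \<FF>' :: "real \<Rightarrow> 'a measure"
    and M'' :: "'w measure" and \<FF>'' :: "real \<Rightarrow> 'w measure"
    and \<C> :: "('dy::finite) rpath metric"
    and \<S> :: "(real \<times> 'a) measure"
    and B :: "real \<Rightarrow> 'a \<Rightarrow> real ^ 'db"
    and X0 :: "'dy rpath \<Rightarrow> 'a \<Rightarrow> real ^ 'dx"
    and A :: "('dy, 'a, real ^ 'dx) field"
    and Sg :: "('dy, 'a, real ^ 'db ^ 'dx) field"
    and F :: "('dy, 'a, real ^ 'dy ^ 'dx) field"
    and F' :: "('dy, 'a, real ^ 'dy ^ 'dy ^ 'dx) field"
    and X Xv :: "('dy, 'a, real ^ 'dx) field"
    and W :: "'w \<Rightarrow> 'dy rpath"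
  assumes T: "0 < T" and \<alpha>: "1 / 3 < \<alpha>" "\<alpha> < 1 / 2" and p: "2 \<le> p"
    and space': "complete_filtered_prob_space T M' \<FF>'"
    and space'': "complete_filtered_prob_space T M'' \<FF>''"
    and \<C>: "polish_rough_path_space T \<alpha> \<C>"
    and B: "brownian_motion T M' \<FF>' B"
    and A1: "assumption1 T \<alpha> p M' \<FF>' \<C> A Sg F F'"
    and \<S>: "\<S> = optional_sigma T M' \<FF>' \<or> \<S> = progressive_sigma T M' \<FF>'"
    and A2: "assumption2 \<C> \<S> \<FF>' X0 A Sg F F'"
    and Xproc: "rough_ito_process T p M' \<FF>' \<C> B X0 A Sg F F' X"
    and Xversion: "is_version T M' \<C> X Xv" "field_measurable \<C> \<S> Xv"
    and W_meas: "W \<in> \<FF>'' T \<rightarrow>\<^sub>M borel_of_metric \<C>"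
    and W_adapted: "adapted T \<FF>'' (\<lambda>t \<omega>. rp_value (W \<omega>) t)"
  shows "adapted T (\<lambda>t. join_sigma (lift1 M' M'' (\<FF>' t)) (lift2 M' M'' (\<FF>'' T))) (randomised Xv W) \<and>
    (\<forall>t\<in>{0..T}.
       regular_conditional_distribution (completion (M' \<Otimes>\<^sub>M M'')) (lift2 M' M'' (\<FF>'' T))
         (randomised Xv W t) (\<lambda>\<omega>. distr M' borel (Xv (W (snd \<omega>)) t))) \<and>
    (\<alpha> * p > 1 \<longrightarrow>
       (\<exists>Z. continuous_modification T (completion (M' \<Otimes>\<^sub>M M'')) (randomised Xv W) Z))"
proof -
  have prob: "prob_space M'" "prob_space M''"
    and sub': "\<And>t. t \<in> {0..T} \<Longrightarrow> subalgebra M' (\<FF>' t)"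
    and sub'': "subalgebra M'' (\<FF>'' T)"
    using space' space'' T by (auto simp: complete_filtered_prob_space_def)
  have space_eq: "space (\<FF>' t) = space M'" if "t \<in> {0..T}" for t
    using sub'[OF that] by (simp add: subalgebra_def)
  have slice: "Pair t \<in> \<FF>' t \<rightarrow>\<^sub>M \<S>" if "t \<in> {0..T}" for t
    using \<S> measurable_section_optional_sigma[of t T \<FF>' M']
      measurable_section_progressive_sigma[of t T \<FF>' M'] that space_eq by auto
  \<comment> \<open>At a fixed time the section map needs only the \<sigma>-field
    \<open>\<FF>' t\<close>, while the whole rough path \<open>W\<close> requires the terminal one
    \<open>\<FF>'' T\<close>.\<close>
  have meas_t: "(\<lambda>(\<omega>', \<omega>''). Xv (W \<omega>'') t \<omega>') \<in> borel_measurable (\<FF>' t \<Otimes>\<^sub>M \<FF>'' T)"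
    if t: "t \<in> {0..T}" for t
  proof -
    note [measurable] = slice[OF t] W_meas
    have "(\<lambda>\<omega>. (W (snd \<omega>), (t, fst \<omega>))) \<in> \<FF>' t \<Otimes>\<^sub>M \<FF>'' T \<rightarrow>\<^sub>M borel_of_metric \<C> \<Otimes>\<^sub>M \<S>"
      by measurable
    from measurable_compose[OF this Xversion(2)[unfolded field_measurable_def]]
    show ?thesis
      by (simp add: case_prod_beta)
  qed
  have randomised: "randomised Xv W t \<in> borel_measurable (\<FF>' t \<Otimes>\<^sub>M \<FF>'' T)"
    if "t \<in> {0..T}" for t
    using meas_t[OF that] by (simp add: randomised_def)
  \<comment> \<open>For (ii) only the first factor is enlarged: the second must remain the
    \<sigma>-field that is conditioned on. For (iii) both are enlarged.\<close>
  have meas': "randomised Xv W t \<in> borel_measurable (M' \<Otimes>\<^sub>M \<FF>'' T)" if t: "t \<in> {0..T}" for t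
    by (rule measurable_pair_subalgebra[OF randomised[OF t] sub'[OF t]]) (simp add: subalgebra_def)
  have meas: "randomised Xv W t \<in> borel_measurable (M' \<Otimes>\<^sub>M M'')" if t: "t \<in> {0..T}" for t
    by (rule measurable_pair_subalgebra[OF randomised[OF t] sub'[OF t] sub''])
  have "adapted T (\<lambda>t. join_sigma (lift1 M' M'' (\<FF>' t)) (lift2 M' M'' (\<FF>'' T))) (randomised Xv W)"
    unfolding adapted_def
  proof
    fix t assume t: "t \<in> {0..T}"
    show "randomised Xv W t \<in> borel_measurable (join_sigma (lift1 M' M'' (\<FF>' t)) (lift2 M' M'' (\<FF>'' T)))"
      using measurable_compose[OF measurable_join_lift randomised[OF t]] space_eq[OF t] sub''
      by (simp add: subalgebra_def)
  qed
  moreover have "regular_conditional_distribution (completion (M' \<Otimes>\<^sub>M M'')) (lift2 M' M'' (\<FF>'' T))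
      (randomised Xv W t) (\<lambda>\<omega>. distr M' borel (Xv (W (snd \<omega>)) t))" if t: "t \<in> {0..T}" for t
    using regular_conditional_distribution_pair[OF prob sub'' meas'[OF t]]
    by (simp add: randomised_def)
  moreover have "\<exists>Z. continuous_modification T (completion (M' \<Otimes>\<^sub>M M'')) (randomised Xv W) Z"
  proof (rule continuous_modification_of_ae_continuous_sections[OF prob meas])
    fix \<omega>'' assume "\<omega>'' \<in> space M''"
    then have "\<omega>'' \<in> space (\<FF>'' T)"
      using sub'' by (simp add: subalgebra_def)
    then have W: "W \<omega>'' \<in> mspace \<C>"
      using measurable_space[OF W_meas] by (simp add: borel_of_metric_def space_measure_of_conv)
    \<comment> \<open>The original process \<open>X\<close> has continuous paths everywhere for each
      fixed rough path; the version \<open>Xv\<close> inherits this almost surely by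
      indistinguishability, with a null set that may depend on \<omega>''.\<close>
    have cont: "continuous_on {0..T} (\<lambda>t. X (W \<omega>'') t \<omega>')" if "\<omega>' \<in> space M'" for \<omega>'
      using Xproc W that by (auto simp: rough_ito_process_def continuous_adapted_def)
    have "AE \<omega>' in M'. \<forall>t\<in>{0..T}. Xv (W \<omega>'') t \<omega>' = X (W \<omega>'') t \<omega>'"
      using Xversion(1) W by (auto simp: is_version_def indistinguishable_def)
    then show "AE \<omega>' in M'. continuous_on {0..T} (\<lambda>t. randomised Xv W t (\<omega>', \<omega>''))"
      using AE_space
    proof eventually_elim
      case (elim \<omega>')
      then show ?case
        using continuous_on_cong[THEN iffD2, OF refl _ cont[of \<omega>']] by (simp add: randomised_def)
    qed
  qed
  ultimately show ?thesis
    by blast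
qed

end
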